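(* For a normal space $X$ the following conditions are equivalent: (a) $X$ has a remote point; (b) there is a closed-open ultrafilter on $X$ with no accumulation points; (c) there exists a non-principal ultrafilter $u$ on $X$ such that $\mathrm{Op}(u)=\mathrm{Cl}(u)$; (d) $X$ is not $\mathrm{NF}$-compact; (e) there is an outer regular finitely additive $\{0,1\}$-measure $\mu$ defined on $\mathrm{wB}(X)$ such that $\mu(A)=0$ for all $A\in\mathrm{NF}$; (f) there is an outer regular finitely additive measure $\mu$ defined on $\mathrm{wB}(X)$ such that $\mu(X)=\infty$ and $\mu(A)<\infty$ for all $A\in\mathrm{NF}$.
   Context: Normal spaces are assumed to be $T_1$ (hence Tychonoff). A filter on a set $X$ is a nonempty family of subsets of $X$ not containing $\emptyset$ and closed under finite intersections and supersets; an ultrafilter on $X$ is a maximal filter. A filter $\mathcal F$ on a space $X$ is an open (resp. closed) filter if it has a base consisting of open (resp. closed) sets; it is an open (resp. closed) ultrafilter if moreover for every open (resp. closed) $A\subseteq X$ either $A\in\mathcal F$ or $X\setminus A\in\mathcal F$. A closed-open ultrafilter is a filter that is both a closed ultrafilter and an open ultrafilter. A point $x\in X$ is an accumulation point of $\mathcal F$ if $x\in\bigcap_{F\in\mathcal F}\overline F$. For an ultrafilter $u$ on $X$, $\mathrm{Op}(u)$ and $\mathrm{Cl}(u)$ are the filters on $X$ generated by all open, respectively all closed, elements of $u$. $\beta(X)$ is the Stone–Čech compactification, $X^*=\beta(X)\setminus X$. A point $p\in X^*$ is remote if $p$ is not in the closure (in $\beta(X)$) of any nowhere dense subset of $X$;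 $X$ has a remote point if some $p\in X^*$ is remote. $\mathrm{NF}$ is the ideal on $X$ generated by all nowhere dense subsets of $X$ together with all finite subsets of $X$ (i.e. all sets $N\cup F$ with $N$ nowhere dense and $F$ finite). For an ideal $J$ on $X$, $X$ is $J$-compact if for each function $\phi$ from $J$ to the family of open subsets of $X$ with $A\subseteq\phi(A)$ for all $A\in J$ there exists a finite family $\mathcal A\subseteq J$ with $\bigcup_{A\in\mathcal A}\phi(A)=X$. $\mathrm{wB}(X)=\{(U\setminus P)\cup Q: U \text{ open in } X,\ P,Q\text{ nowhere dense in }X\}$; this is an algebra of subsets of $X$, the smallest one containing all open and all nowhere dense sets. For an algebra $\mathcal A$ of subsets of $X$, a function $\mu\colon\mathcal A\to[0,\infty]$ is a finitely additive measure if $\mu(A\cup B)=\mu(A)+\mu(B)$ for all disjoint $A,B\in\mathcal A$. It is a finitely additive $\{0,1\}$-measure if in addition it takes only the values $0$ and $1$ and $\mu(X)=1$. It is outer regular if for each $A\in\mathcal A$, $\mu(A)=\inf\{\mu(U): A\subseteq U,\ U\text{ open}\}$. *)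

theory Defs
  imports "HOL-Analysis.Analysis"
begin

section \<open>Filters on a set and on a space\<close>

text \<open>Filters are families of subsets of the given underlying set. The HOL type of filters is not
  used: its elements live on a whole type and include the improper filter.\<close>

definition filter_on :: "'a set \<Rightarrow> 'a set set \<Rightarrow> bool" where
  "filter_on S \<F> \<longleftrightarrow>
     \<F> \<subseteq> Pow S \<and> \<F> \<noteq> {} \<and> {} \<notin> \<F> \<and>
     (\<forall>A\<in>\<F>. \<forall>B\<in>\<F>. A \<inter> B \<in> \<F>) \<and>
     (\<forall>A\<in>\<F>. \<forall>B. A \<subseteq> B \<and> B \<subseteq> S \<longrightarrow> B \<in> \<F>)"

definition ultrafilter_on :: "'a set \<Rightarrow> 'a set set \<Rightarrow> bool" where
  "ultrafilter_on S \<F> \<longleftrightarrow>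
     filter_on S \<F> \<and> (\<forall>\<G>. filter_on S \<G> \<and> \<F> \<subseteq> \<G> \<longrightarrow> \<G> = \<F>)"

definition principal_on :: "'a set \<Rightarrow> 'a set set \<Rightarrow> bool" where
  "principal_on S \<F> \<longleftrightarrow> (\<exists>x\<in>S. \<F> = {A. A \<subseteq> S \<and> x \<in> A})"

text \<open>The filter generated by a family: supersets of finite intersections of its members
  (the empty intersection being the whole set).\<close>

definition generated_filter :: "'a set \<Rightarrow> 'a set set \<Rightarrow> 'a set set" where
  "generated_filter S \<B> = {A. A \<subseteq> S \<and> (\<exists>\<C>. finite \<C> \<and> \<C> \<subseteq> \<B> \<and> S \<inter> \<Inter>\<C> \<subseteq> A)}"

definition open_filter :: "'a topology \<Rightarrow> 'a set set \<Rightarrow> bool" where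
  "open_filter X \<F> \<longleftrightarrow>
     filter_on (topspace X) \<F> \<and> (\<forall>A\<in>\<F>. \<exists>U\<in>\<F>. openin X U \<and> U \<subseteq> A)"

definition closed_filter :: "'a topology \<Rightarrow> 'a set set \<Rightarrow> bool" where
  "closed_filter X \<F> \<longleftrightarrow>
     filter_on (topspace X) \<F> \<and> (\<forall>A\<in>\<F>. \<exists>C\<in>\<F>. closedin X C \<and> C \<subseteq> A)"

definition open_ultrafilter :: "'a topology \<Rightarrow> 'a set set \<Rightarrow> bool" where
  "open_ultrafilter X \<F> \<longleftrightarrow>
     open_filter X \<F> \<and> (\<forall>A. openin X A \<longrightarrow> A \<in> \<F> \<or> topspace X - A \<in> \<F>)"

definition closed_ultrafilter :: "'a topology \<Rightarrow> 'a set set \<Rightarrow> bool" where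
  "closed_ultrafilter X \<F> \<longleftrightarrow>
     closed_filter X \<F> \<and> (\<forall>A. closedin X A \<longrightarrow> A \<in> \<F> \<or> topspace X - A \<in> \<F>)"

definition closed_open_ultrafilter :: "'a topology \<Rightarrow> 'a set set \<Rightarrow> bool" where
  "closed_open_ultrafilter X \<F> \<longleftrightarrow> closed_ultrafilter X \<F> \<and> open_ultrafilter X \<F>"

definition accumulation_point :: "'a topology \<Rightarrow> 'a set set \<Rightarrow> 'a \<Rightarrow> bool" where
  "accumulation_point X \<F> x \<longleftrightarrow> x \<in> topspace X \<and> (\<forall>F\<in>\<F>. x \<in> X closure_of F)"

definition Op :: "'a topology \<Rightarrow> 'a set set \<Rightarrow> 'a set set" where
  "Op X u = generated_filter (topspace X) {A\<in>u. openin X A}"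

definition Cl :: "'a topology \<Rightarrow> 'a set set \<Rightarrow> 'a set set" where
  "Cl X u = generated_filter (topspace X) {A\<in>u. closedin X A}"


section \<open>The Stone--Cech compactification and remote points\<close>

text \<open>\<open>\<beta>(X)\<close> is the closure of the image of \<open>X\<close> under the evaluation map into the cube
  \<open>[0,1]\<^bsup>C(X,[0,1])\<^esup>\<close>. Requiring the index functions to be extensional makes each continuous
  function on the carrier occur exactly once.\<close>

definition unit_functions :: "'a topology \<Rightarrow> ('a \<Rightarrow> real) set" where
  "unit_functions X =
     {f \<in> extensional (topspace X). continuous_map X (top_of_set {0..1}) f}"

definition SC_cube :: "'a topology \<Rightarrow> (('a \<Rightarrow> real) \<Rightarrow> real) topology" where
  "SC_cube X = product_topology (\<lambda>f. top_of_set {0..1}) (unit_functions X)"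

definition SC_map :: "'a topology \<Rightarrow> 'a \<Rightarrow> ('a \<Rightarrow> real) \<Rightarrow> real" where
  "SC_map X x = (\<lambda>f\<in>unit_functions X. f x)"

definition Stone_Cech :: "'a topology \<Rightarrow> (('a \<Rightarrow> real) \<Rightarrow> real) topology" where
  "Stone_Cech X = subtopology (SC_cube X) (SC_cube X closure_of (SC_map X ` topspace X))"

definition nowhere_dense_in :: "'a topology \<Rightarrow> 'a set \<Rightarrow> bool" where
  "nowhere_dense_in X N \<longleftrightarrow> N \<subseteq> topspace X \<and> X interior_of (X closure_of N) = {}"

definition remote_point :: "'a topology \<Rightarrow> (('a \<Rightarrow> real) \<Rightarrow> real) \<Rightarrow> bool" where
  "remote_point X p \<longleftrightarrow>
     p \<in> topspace (Stone_Cech X) - SC_map X ` topspace X \<and>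
     (\<forall>N. nowhere_dense_in X N \<longrightarrow> p \<notin> Stone_Cech X closure_of (SC_map X ` N))"

text \<open>The space just defined is a compactification of a Tychonoff space to which
  all continuous functions into the unit interval extend.\<close>

lemma unit_functions_eq_mspace:
  "unit_functions X =
     mspace (submetric (cfunspace X euclidean_metric) {f. f \<in> topspace X \<rightarrow> {0..1::real}})"
proof -
  have "bounded (f ` topspace X)" if "f \<in> topspace X \<rightarrow> {0..1::real}" for f
    using that by (intro bounded_subset[OF bounded_closed_interval[of 0 1]]) auto
  then show ?thesis
    by (auto simp: unit_functions_def continuous_map_in_subtopology image_subset_iff Pi_iff)
qed

lemma topspace_SC_map: "SC_map X ` topspace X \<subseteq> topspace (SC_cube X)"
  by (fastforce simp: SC_map_def SC_cube_def unit_functions_def continuous_map_in_subtopology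
      image_subset_iff Pi_iff PiE_iff)

lemma SC_map_subset_closure:
  "SC_map X ` topspace X \<subseteq> SC_cube X closure_of (SC_map X ` topspace X)"
  by (rule closure_of_subset[OF topspace_SC_map])

lemma embedding_map_SC_map:
  assumes "completely_regular_space X" "Hausdorff_space X"
  shows "embedding_map X (Stone_Cech X) (SC_map X)"
proof -
  have "embedding_map X (SC_cube X) (SC_map X)"
    using completely_regular_space_cube_embedding_explicit[OF assms]
    unfolding SC_cube_def SC_map_def unit_functions_eq_mspace .
  then show ?thesis
    unfolding Stone_Cech_def embedding_map_in_subtopology
    using SC_map_subset_closure[of X] by blast
qed

lemma compact_space_Stone_Cech: "compact_space (Stone_Cech X)"
proof -
  have "compact_space (SC_cube X)"
    unfolding SC_cube_def
    by (simp add: compact_space_product_topology compact_space_subtopology)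
  then show ?thesis
    by (simp add: Stone_Cech_def compact_space_subtopology closedin_compact_space)
qed

lemma Hausdorff_space_Stone_Cech: "Hausdorff_space (Stone_Cech X)"
  unfolding Stone_Cech_def SC_cube_def
  by (intro Hausdorff_space_subtopology)
     (simp add: Hausdorff_space_product_topology Hausdorff_space_subtopology)

lemma dense_Stone_Cech:
  "Stone_Cech X closure_of (SC_map X ` topspace X) = topspace (Stone_Cech X)"
  using SC_map_subset_closure[of X] closure_of_subset_topspace[of "SC_cube X"]
  by (auto simp: Stone_Cech_def closure_of_subtopology Int_absorb1)

lemma Stone_Cech_extension:
  assumes "continuous_map X (top_of_set {0..1::real}) g"
  obtains h where "continuous_map (Stone_Cech X) (top_of_set {0..1::real}) h"
    and "\<And>x. x \<in> topspace X \<Longrightarrow> h (SC_map X x) = g x"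
proof
  let ?g = "restrict g (topspace X)"
  have g: "?g \<in> unit_functions X"
    using continuous_map_eq[OF assms, of ?g] by (simp add: unit_functions_def)
  show "continuous_map (Stone_Cech X) (top_of_set {0..1}) (\<lambda>p. p ?g)"
    unfolding Stone_Cech_def SC_cube_def
    by (intro continuous_map_from_subtopology continuous_map_product_projection[OF g])
  show "SC_map X x ?g = g x" if "x \<in> topspace X" for x
    using that g by (simp add: SC_map_def)
qed


section \<open>The ideal NF and J-compactness\<close>

definition NF :: "'a topology \<Rightarrow> 'a set set" where
  "NF X = {N \<union> F | N F. nowhere_dense_in X N \<and> finite F \<and> F \<subseteq> topspace X}"

definition ideal_compact :: "'a topology \<Rightarrow> 'a set set \<Rightarrow> bool" where
  "ideal_compact X J \<longleftrightarrow>
     (\<forall>\<phi>. (\<forall>A\<in>J. openin X (\<phi> A) \<and> A \<subseteq> \<phi> A) \<longrightarrow>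
        (\<exists>\<A>. finite \<A> \<and> \<A> \<subseteq> J \<and> (\<Union>A\<in>\<A>. \<phi> A) = topspace X))"


section \<open>Finitely additive measures\<close>

definition wB :: "'a topology \<Rightarrow> 'a set set" where
  "wB X = {(U - P) \<union> Q | U P Q. openin X U \<and> nowhere_dense_in X P \<and> nowhere_dense_in X Q}"

text \<open>As no value at the empty set is prescribed, the constant \<open>\<infinity>\<close> is also a finitely additive
  measure. Values outside the algebra are irrelevant.\<close>

abbreviation finitely_additive_measure :: "'a set set \<Rightarrow> ('a set \<Rightarrow> ennreal) \<Rightarrow> bool" where
  "finitely_additive_measure \<equiv> additive"

definition finitely_additive_01_measure ::
  "'a topology \<Rightarrow> 'a set set \<Rightarrow> ('a set \<Rightarrow> ennreal) \<Rightarrow> bool" where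
  "finitely_additive_01_measure X \<A> \<mu> \<longleftrightarrow>
     finitely_additive_measure \<A> \<mu> \<and> (\<forall>A\<in>\<A>. \<mu> A = 0 \<or> \<mu> A = 1) \<and> \<mu> (topspace X) = 1"

definition outer_regular_on ::
  "'a topology \<Rightarrow> 'a set set \<Rightarrow> ('a set \<Rightarrow> ennreal) \<Rightarrow> bool" where
  "outer_regular_on X \<A> \<mu> \<longleftrightarrow> (\<forall>A\<in>\<A>. \<mu> A = Inf {\<mu> U | U. openin X U \<and> A \<subseteq> U})"

end

theory Submission
  imports Defs
begin

text \<open>All six conditions are compared with the existence of an ultrafilter \<open>u\<close> such that every
  member of \<open>NF\<close> is disjoint from some closed member of \<open>u\<close>. Applied to the nowhere dense boundaries
  of open and of closed sets, this property lets one shrink open members of \<open>u\<close> to closed ones and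
  conversely, so \<open>Op(u) = Cl(u)\<close> is a closed-open ultrafilter. Passing to complements of closed
  members turns the property into the failure of \<open>NF\<close>-compactness. The traces on \<open>X\<close> of the
  neighbourhoods of a remote point extend to such a \<open>u\<close>, by regularity of \<open>\<beta>(X)\<close>; conversely \<open>u\<close>
  accumulates at a remote point, because disjoint closed subsets of a normal space have disjoint
  closures in \<open>\<beta>(X)\<close>. The measure is the indicator function of \<open>u\<close>, times \<open>\<infinity>\<close> for the last
  condition; conversely, outer regularity yields open supersets of finite measure, finitely many
  of which would cover \<open>X\<close> if \<open>X\<close> were \<open>NF\<close>-compact.\<close>

section \<open>Ultrafilters on a set\<close>

lemma
  assumes "filter_on S F"
  shows filter_on_subset: "A \<in> F \<Longrightarrow> A \<subseteq> S"
    and filter_on_empty: "{} \<notin> F"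
    and filter_on_Int: "A \<in> F \<Longrightarrow> B \<in> F \<Longrightarrow> A \<inter> B \<in> F"
    and filter_on_mono: "A \<in> F \<Longrightarrow> A \<subseteq> B \<Longrightarrow> B \<subseteq> S \<Longrightarrow> B \<in> F"
    and filter_on_top: "S \<in> F"
proof -
  show sub: "A \<in> F \<Longrightarrow> A \<subseteq> S" for A
    using assms by (auto simp: filter_on_def)
  show "{} \<notin> F" "A \<in> F \<Longrightarrow> B \<in> F \<Longrightarrow> A \<inter> B \<in> F"
    using assms by (simp_all add: filter_on_def)
  show mono: "A \<in> F \<Longrightarrow> A \<subseteq> B \<Longrightarrow> B \<subseteq> S \<Longrightarrow> B \<in> F" for A B
    using assms unfolding filter_on_def by metis
  have "F \<noteq> {}"
    using assms by (simp add: filter_on_def)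
  then obtain A where "A \<in> F" by blast
  then show "S \<in> F"
    using mono[of A S] sub[of A] by simp
qed

lemma filter_onI:
  assumes "\<And>A. A \<in> F \<Longrightarrow> A \<subseteq> S" "S \<in> F" "{} \<notin> F"
    and "\<And>A B. A \<in> F \<Longrightarrow> B \<in> F \<Longrightarrow> A \<inter> B \<in> F"
    and "\<And>A B. A \<in> F \<Longrightarrow> A \<subseteq> B \<Longrightarrow> B \<subseteq> S \<Longrightarrow> B \<in> F"
  shows "filter_on S F"
  unfolding filter_on_def using assms by (intro conjI ballI allI impI) auto

lemma filter_on_Inter:
  assumes "filter_on S F" "finite \<C>" "\<C> \<subseteq> F"
  shows "S \<inter> \<Inter>\<C> \<in> F"
  using assms(2,3)
proof (induction \<C>)
  case empty
  then show ?case using filter_on_top[OF assms(1)] by simp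
next
  case (insert A \<C>)
  then have "A \<inter> (S \<inter> \<Inter>\<C>) \<in> F"
    using filter_on_Int[OF assms(1), of A "S \<inter> \<Inter>\<C>"] by simp
  then show ?case by (simp add: ac_simps)
qed

text \<open>The hypothesis for the empty family says that \<open>S\<close> is nonempty. Closure
  under intersection comes from joining the two finite families that witness membership.\<close>

lemma filter_on_generated_filter:
  assumes "\<And>\<C>. finite \<C> \<Longrightarrow> \<C> \<subseteq> \<B> \<Longrightarrow> S \<inter> \<Inter>\<C> \<noteq> {}"
  shows "filter_on S (generated_filter S \<B>)"
proof (rule filter_onI)
  fix A B
  show "A \<subseteq> S" if "A \<in> generated_filter S \<B>"
    using that by (simp add: generated_filter_def)
  show "A \<inter> B \<in> generated_filter S \<B>"
    if AB: "A \<in> generated_filter S \<B>" "B \<in> generated_filter S \<B>"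
  proof -
    obtain \<C> where "finite \<C>" "\<C> \<subseteq> \<B>" "S \<inter> \<Inter>\<C> \<subseteq> A" "A \<subseteq> S"
      using AB(1) by (auto simp: generated_filter_def)
    moreover obtain \<D> where "finite \<D>" "\<D> \<subseteq> \<B>" "S \<inter> \<Inter>\<D> \<subseteq> B"
      using AB(2) by (auto simp: generated_filter_def)
    ultimately show ?thesis
      unfolding generated_filter_def by (auto intro!: exI[of _ "\<C> \<union> \<D>"])
  qed
  show "B \<in> generated_filter S \<B>" if "A \<in> generated_filter S \<B>" "A \<subseteq> B" "B \<subseteq> S"
    using that unfolding generated_filter_def by (simp, meson order_trans)
next
  show "S \<in> generated_filter S \<B>"
    by (auto simp: generated_filter_def intro!: exI[of _ "{}"])
  show "{} \<notin> generated_filter S \<B>"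
    using assms by (auto simp: generated_filter_def)
qed

lemma subset_generated_filter:
  assumes "\<B> \<subseteq> Pow S"
  shows "\<B> \<subseteq> generated_filter S \<B>"
proof
  fix A assume "A \<in> \<B>"
  with assms show "A \<in> generated_filter S \<B>"
    unfolding generated_filter_def by (auto intro!: exI[of _ "{A}"])
qed

text \<open>Closure under binary intersections, with \<open>S\<close> for the empty one, puts every
  finite intersection back into the family, so the family is itself a base. This is meant for the
  open members and for the closed members of an ultrafilter.\<close>

lemma generated_filter_eq:
  assumes "filter_on S u" "\<B> \<subseteq> u" "S \<in> \<B>" "\<And>A B. A \<in> \<B> \<Longrightarrow> B \<in> \<B> \<Longrightarrow> A \<inter> B \<in> \<B>"
  shows "generated_filter S \<B> = {A. A \<subseteq> S \<and> (\<exists>B\<in>\<B>. B \<subseteq> A)}"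
proof -
  have *: "S \<inter> \<Inter>\<C> \<in> \<B>" if "finite \<C>" "\<C> \<subseteq> \<B>" for \<C>
    using that
  proof (induction \<C>)
    case (insert A \<C>)
    then have "A \<inter> (S \<inter> \<Inter>\<C>) \<in> \<B>"
      using assms(4) by blast
    then show ?case by (simp add: ac_simps)
  qed (use assms in simp)
  have "\<B> \<subseteq> Pow S"
    using assms(1,2) unfolding filter_on_def by (meson order_trans)
  then have "\<exists>\<C>. finite \<C> \<and> \<C> \<subseteq> \<B> \<and> S \<inter> \<Inter>\<C> \<subseteq> A" if "B \<in> \<B>" "B \<subseteq> A" for A B
    using that by (intro exI[of _ "{B}"]) auto
  with * show ?thesis
    unfolding generated_filter_def by blast
qed

text \<open>Zorn's lemma: two members of the union of a chain of filters already lie in one filter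
  of the chain, so the union is again a filter.\<close>

lemma ultrafilter_extends_filter:
  assumes "filter_on S F"
  obtains u where "ultrafilter_on S u" "F \<subseteq> u"
proof -
  let ?A = "{G. filter_on S G \<and> F \<subseteq> G}"
  have "\<exists>M\<in>?A. \<forall>G\<in>?A. M \<subseteq> G \<longrightarrow> G = M"
  proof (rule subset_Zorn_nonempty)
    show "?A \<noteq> {}" using assms by blast
    fix \<C> assume "\<C> \<noteq> {}" and ch: "subset.chain ?A \<C>"
    have C: "filter_on S G" "F \<subseteq> G" if "G \<in> \<C>" for G
      using ch that by (auto simp: subset_chain_def)
    have "filter_on S (\<Union>\<C>)"
    proof (rule filter_onI)
      fix A B
      show "A \<inter> B \<in> \<Union>\<C>" if AB: "A \<in> \<Union>\<C>" "B \<in> \<Union>\<C>"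
      proof -
        obtain G H where GH: "G \<in> \<C>" "H \<in> \<C>" "A \<in> G" "B \<in> H"
          using AB by blast
        moreover have "G \<subseteq> H \<or> H \<subseteq> G"
          using ch GH(1,2) by (auto simp: subset_chain_def)
        ultimately obtain K where "K \<in> \<C>" "A \<in> K" "B \<in> K" by blast
        then show ?thesis using filter_on_Int[OF C(1)] by blast
      qed
      show "A \<subseteq> S" if "A \<in> \<Union>\<C>"
        using that filter_on_subset[OF C(1)] by blast
      show "B \<in> \<Union>\<C>" if "A \<in> \<Union>\<C>" "A \<subseteq> B" "B \<subseteq> S"
        using that filter_on_mono[OF C(1)] by blast
    next
      show "S \<in> \<Union>\<C>"
        using filter_on_top[OF C(1)] \<open>\<C> \<noteq> {}\<close> by blast
      show "{} \<notin> \<Union>\<C>"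
        using filter_on_empty[OF C(1)] by blast
    qed
    moreover have "F \<subseteq> \<Union>\<C>"
      using C(2) \<open>\<C> \<noteq> {}\<close> by blast
    ultimately show "\<Union>\<C> \<in> ?A" by simp
  qed
  then obtain M where "filter_on S M" "F \<subseteq> M"
    and "\<And>G. filter_on S G \<Longrightarrow> F \<subseteq> G \<Longrightarrow> M \<subseteq> G \<Longrightarrow> G = M"
    by auto
  then show ?thesis
    by (intro that[of M]) (auto simp: ultrafilter_on_def)
qed

section \<open>Complements and unions in an ultrafilter\<close>

lemma ultrafilter_on_filter: "ultrafilter_on S u \<Longrightarrow> filter_on S u"
  by (simp add: ultrafilter_on_def)

lemmas ultrafilter_on_subset = filter_on_subset[OF ultrafilter_on_filter]
  and ultrafilter_on_top = filter_on_top[OF ultrafilter_on_filter]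
  and ultrafilter_on_empty = filter_on_empty[OF ultrafilter_on_filter]
  and ultrafilter_on_Int = filter_on_Int[OF ultrafilter_on_filter]
  and ultrafilter_on_mono = filter_on_mono[OF ultrafilter_on_filter]

lemmas ultrafilter_on_dest = ultrafilter_on_subset ultrafilter_on_top ultrafilter_on_empty
  ultrafilter_on_Int ultrafilter_on_mono ultrafilter_on_filter

lemma ultrafilter_on_compl_iff:
  assumes "ultrafilter_on S u" "A \<subseteq> S"
  shows "S - A \<in> u \<longleftrightarrow> A \<notin> u"
proof
  note u = ultrafilter_on_dest[OF assms(1)]
  show "A \<notin> u" if "S - A \<in> u"
    using u(4)[OF that, of A] u(3) by (auto simp: Int_commute Diff_disjoint)
  assume "A \<notin> u"
  \<comment> \<open>\<open>?G\<close> is the family generated by \<open>u\<close> and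
    \<open>A\<close>. If it omitted the empty set, it would be a filter properly extending
    \<open>u\<close>, against maximality. Hence some \<open>F\<close> in \<open>u\<close> misses
    \<open>A\<close>.\<close>
  let ?G = "{B. B \<subseteq> S \<and> (\<exists>F\<in>u. F \<inter> A \<subseteq> B)}"
  have "A \<in> ?G" "u \<subseteq> ?G"
    using u(1,2) assms(2) by blast+
  have "\<not> filter_on S ?G"
  proof
    assume "filter_on S ?G"
    then have "?G = u"
      using assms(1) \<open>u \<subseteq> ?G\<close> by (simp add: ultrafilter_on_def)
    with \<open>A \<in> ?G\<close> \<open>A \<notin> u\<close> show False by simp
  qed
  have "{} \<in> ?G"
  proof (rule ccontr)
    assume "{} \<notin> ?G"
    have "filter_on S ?G"
    proof (rule filter_onI)
      fix B C
      show "B \<inter> C \<in> ?G" if B: "B \<in> ?G" and C: "C \<in> ?G"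
      proof -
        obtain F G where "F \<in> u" "G \<in> u" "F \<inter> A \<subseteq> B" "G \<inter> A \<subseteq> C"
          using B C by blast
        then have "F \<inter> G \<in> u" "(F \<inter> G) \<inter> A \<subseteq> B \<inter> C"
          using u(4) by blast+
        then show ?thesis using B by blast
      qed
      show "B \<subseteq> S" if "B \<in> ?G"
        using that by simp
      show "C \<in> ?G" if "B \<in> ?G" "B \<subseteq> C" "C \<subseteq> S"
        using that by (simp, meson order_trans)
    qed (use u(2) \<open>{} \<notin> ?G\<close> in auto)
    with \<open>\<not> filter_on S ?G\<close> show False ..
  qed
  then obtain F where "F \<in> u" "F \<inter> A = {}" by blast
  moreover from this have "F \<subseteq> S - A"
    using u(1)[of F] by blast
  ultimately show "S - A \<in> u"
    using u(5) by blast
qed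

lemma ultrafilter_on_Un_iff:
  assumes "ultrafilter_on S u" "A \<subseteq> S" "B \<subseteq> S"
  shows "A \<union> B \<in> u \<longleftrightarrow> A \<in> u \<or> B \<in> u"
proof
  assume "A \<union> B \<in> u"
  show "A \<in> u \<or> B \<in> u"
  proof (rule ccontr)
    assume "\<not> (A \<in> u \<or> B \<in> u)"
    then have "(S - A) \<inter> (S - B) \<in> u"
      using assms by (simp add: ultrafilter_on_compl_iff ultrafilter_on_Int)
    then show False
      using ultrafilter_on_compl_iff[OF assms(1), of "A \<union> B"] assms \<open>A \<union> B \<in> u\<close>
      by (simp add: Diff_Un)
  qed
qed (use ultrafilter_on_mono[OF assms(1)] assms in blast)

section \<open>Nowhere dense sets and the algebra they generate\<close>

lemma nowhere_dense_in_Un: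
  assumes "nowhere_dense_in X M" "nowhere_dense_in X N"
  shows "nowhere_dense_in X (M \<union> N)"
  using assms by (simp add: nowhere_dense_in_def closure_of_Un interior_of_union_eq_empty)

lemma nowhere_dense_in_empty: "nowhere_dense_in X {}"
  by (simp add: nowhere_dense_in_def)

lemma nowhere_dense_in_mono:
  assumes "nowhere_dense_in X N" "M \<subseteq> N"
  shows "nowhere_dense_in X M"
  using assms interior_of_mono[OF closure_of_mono[OF assms(2), of X], of X]
  by (auto simp: nowhere_dense_in_def)

lemma nowhere_dense_in_closure: "nowhere_dense_in X N \<Longrightarrow> nowhere_dense_in X (X closure_of N)"
  by (simp add: nowhere_dense_in_def closure_of_subset_topspace)

text \<open>An open set inside \<open>C - X interior_of C\<close> is an open subset of
  \<open>C\<close>, hence it lies in the interior that has been removed and is empty. The difference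
  is closed, so no closure has to be taken.\<close>

lemma nowhere_dense_in_Diff_interior:
  assumes "closedin X C"
  shows "nowhere_dense_in X (C - X interior_of C)"
proof -
  let ?N = "C - X interior_of C"
  have "closedin X ?N"
    using assms by (simp add: closedin_diff)
  moreover have "X interior_of ?N = {}"
    using interior_of_mono[of ?N C X] interior_of_subset[of X ?N] by blast
  ultimately show ?thesis
    using closedin_subset by (simp add: nowhere_dense_in_def closure_of_closedin)
qed

text \<open>An open set has the same boundary as its closed complement, to which the preceding lemma
  applies.\<close>

lemma nowhere_dense_in_closure_Diff:
  assumes "openin X U"
  shows "nowhere_dense_in X (X closure_of U - U)"
proof -
  let ?D = "topspace X - U"
  have "X closure_of U - U = ?D - X interior_of ?D"
    using closure_of_subset_topspace[of X U] by (auto simp: interior_of_complement)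
  then show ?thesis
    using nowhere_dense_in_Diff_interior[OF closedin_diff[OF closedin_topspace assms]] by simp
qed

section \<open>Membership in the ideal and in the algebra\<close>

lemma NF_nowhere_dense: "nowhere_dense_in X N \<Longrightarrow> N \<in> NF X"
  unfolding NF_def by blast

lemma NF_sing: "x \<in> topspace X \<Longrightarrow> {x} \<in> NF X"
  unfolding NF_def using nowhere_dense_in_empty by blast

lemma NF_subset: "A \<in> NF X \<Longrightarrow> A \<subseteq> topspace X"
  unfolding NF_def nowhere_dense_in_def by blast

lemma wB_subset: "A \<in> wB X \<Longrightarrow> A \<subseteq> topspace X"
  by (auto simp: wB_def nowhere_dense_in_def dest: openin_subset)

lemma open_Un_nowhere_dense_in_wB:
  assumes "openin X U" "nowhere_dense_in X N"
  shows "U \<union> N \<in> wB X"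
  unfolding wB_def using assms nowhere_dense_in_empty by blast

lemma openin_wB: "openin X U \<Longrightarrow> U \<in> wB X"
  using open_Un_nowhere_dense_in_wB[OF _ nowhere_dense_in_empty] by simp

text \<open>Off the closure of \<open>U\<close> the difference is open; the rest lies in the
  boundary of \<open>U\<close>. This supplies the pieces needed for subadditivity on open
  sets.\<close>

lemma openin_Diff_wB:
  assumes "openin X V" "openin X U"
  shows "V - U \<in> wB X"
proof -
  have "V - U = (V - X closure_of U) \<union> (V \<inter> (X closure_of U - U))"
    using closure_of_subset[OF openin_subset[OF assms(2)]] by blast
  moreover have "openin X (V - X closure_of U)"
    using assms(1) by (simp add: openin_diff)
  moreover have "nowhere_dense_in X (V \<inter> (X closure_of U - U))"
    by (rule nowhere_dense_in_mono[OF nowhere_dense_in_closure_Diff[OF assms(2)]]) blast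
  ultimately show ?thesis
    using open_Un_nowhere_dense_in_wB by metis
qed

text \<open>A finite set may contain isolated points and so fail to be nowhere dense. It is closed
  in a T1 space, hence it splits into its open interior and a nowhere dense remainder.\<close>

lemma NF_subset_wB:
  assumes "t1_space X"
  shows "NF X \<subseteq> wB X"
proof
  fix A assume "A \<in> NF X"
  then obtain N E where A: "A = N \<union> E" "nowhere_dense_in X N" "finite E" "E \<subseteq> topspace X"
    unfolding NF_def by blast
  have "closedin X E"
    using assms A(3,4) by (simp add: t1_space_closedin_finite)
  then have "nowhere_dense_in X (N \<union> (E - X interior_of E))"
    using A(2) nowhere_dense_in_Un nowhere_dense_in_Diff_interior by blast
  moreover have "A = X interior_of E \<union> (N \<union> (E - X interior_of E))"
    using A(1) interior_of_subset[of X E] by blast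
  ultimately show "A \<in> wB X"
    using open_Un_nowhere_dense_in_wB[OF openin_interior_of] by metis
qed

section \<open>Remote ultrafilters\<close>

text \<open>The separation by a closed member is stronger than \<open>A \<notin> u\<close>: on the
  real line an ultrafilter that converges to 0 and contains all dense open sets has no member in
  \<open>NF\<close>, yet all its closed members contain 0.\<close>

definition remote_ultrafilter :: "'a topology \<Rightarrow> 'a set set \<Rightarrow> bool" where
  "remote_ultrafilter X u \<longleftrightarrow>
     ultrafilter_on (topspace X) u \<and> (\<forall>A\<in>NF X. \<exists>C\<in>u. closedin X C \<and> C \<inter> A = {})"

lemma remote_ultrafilter_ultrafilter:
  "remote_ultrafilter X u \<Longrightarrow> ultrafilter_on (topspace X) u"
  unfolding remote_ultrafilter_def by blast

lemma remote_ultrafilter_NF: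
  assumes "remote_ultrafilter X u" "A \<in> NF X"
  obtains C where "C \<in> u" "closedin X C" "C \<inter> A = {}"
  using assms unfolding remote_ultrafilter_def by blast

lemma remote_ultrafilter_not_NF:
  assumes "remote_ultrafilter X u" "A \<in> NF X"
  shows "A \<notin> u"
proof
  note u = ultrafilter_on_dest[OF remote_ultrafilter_ultrafilter[OF assms(1)]]
  assume "A \<in> u"
  obtain C where "C \<in> u" "C \<inter> A = {}"
    using remote_ultrafilter_NF[OF assms] by blast
  then show False
    using u(3) u(4)[of C A] \<open>A \<in> u\<close> by simp
qed

text \<open>Closed members of \<open>u\<close> are stable under finite intersections, so a nowhere
  dense set and finitely many points can be avoided one after the other.\<close>

lemma remote_ultrafilterI:
  assumes u: "ultrafilter_on (topspace X) u"
    and nd: "\<And>N. nowhere_dense_in X N \<Longrightarrow> \<exists>C\<in>u. closedin X C \<and> C \<inter> N = {}"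
    and sing: "\<And>x. x \<in> topspace X \<Longrightarrow> \<exists>C\<in>u. closedin X C \<and> x \<notin> C"
  shows "remote_ultrafilter X u"
proof -
  have "\<exists>C\<in>u. closedin X C \<and> C \<inter> A = {}" if "A \<in> NF X" for A
  proof -
    obtain N E where A: "A = N \<union> E" "nowhere_dense_in X N" and E: "finite E" "E \<subseteq> topspace X"
      using \<open>A \<in> NF X\<close> unfolding NF_def by blast
    from E have "\<exists>C\<in>u. closedin X C \<and> C \<inter> E = {}"
    proof (induction E)
      case empty
      then show ?case using ultrafilter_on_top[OF u] by auto
    next
      case (insert x E)
      then obtain C D where "C \<in> u" "closedin X C" "C \<inter> E = {}" "D \<in> u" "closedin X D" "x \<notin> D"
        using sing[of x] by auto
      then show ?case
        using ultrafilter_on_Int[OF u, of C D] by (intro bexI[of _ "C \<inter> D"]) auto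
    qed
    then obtain C D where "C \<in> u" "closedin X C" "C \<inter> E = {}" "D \<in> u" "closedin X D" "D \<inter> N = {}"
      using nd[OF A(2)] by blast
    then show ?thesis
      using ultrafilter_on_Int[OF u, of C D] A(1) by (intro bexI[of _ "C \<inter> D"]) auto
  qed
  with u show ?thesis
    unfolding remote_ultrafilter_def by blast
qed

text \<open>A closed member \<open>D\<close> that avoids the boundary of \<open>U\<close> meets the
  closure of \<open>U\<close> only inside \<open>U\<close>.\<close>

lemma remote_ultrafilter_closed_subset:
  assumes "remote_ultrafilter X u" "U \<in> u" "openin X U"
  obtains C where "C \<in> u" "closedin X C" "C \<subseteq> U"
proof -
  note u = ultrafilter_on_dest[OF remote_ultrafilter_ultrafilter[OF assms(1)]]
  obtain D where D: "D \<in> u" "closedin X D" "D \<inter> (X closure_of U - U) = {}"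
    using remote_ultrafilter_NF[OF assms(1) NF_nowhere_dense[OF nowhere_dense_in_closure_Diff[OF assms(3)]]]
    by blast
  have "X closure_of U \<in> u"
    using u(5)[OF assms(2)] closure_of_subset[OF openin_subset[OF assms(3)]] closure_of_subset_topspace
    by metis
  with D show thesis
    by (intro that[of "D \<inter> X closure_of U"]) (auto intro: u(4))
qed

text \<open>A member \<open>D\<close> that avoids the boundary of \<open>C\<close> satisfies
  \<open>D \<inter> C \<subseteq> X interior_of C\<close>, which forces the interior into
  \<open>u\<close>.\<close>

lemma remote_ultrafilter_open_subset:
  assumes "remote_ultrafilter X u" "C \<in> u" "closedin X C"
  obtains U where "U \<in> u" "openin X U" "U \<subseteq> C"
proof -
  note u = ultrafilter_on_dest[OF remote_ultrafilter_ultrafilter[OF assms(1)]]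
  obtain D where D: "D \<in> u" "D \<inter> (C - X interior_of C) = {}"
    using remote_ultrafilter_NF[OF assms(1) NF_nowhere_dense[OF nowhere_dense_in_Diff_interior[OF assms(3)]]]
    by blast
  have "X interior_of C \<in> u"
    using D(2) by (intro u(5)[OF u(4)[OF D(1) assms(2)]]) (auto simp: interior_of_subset_topspace)
  then show thesis
    by (rule that) (rule openin_interior_of interior_of_subset)+
qed

section \<open>Open and closed members generating the same filter\<close>

lemma Op_eq:
  assumes "ultrafilter_on (topspace X) u"
  shows "Op X u = {A. A \<subseteq> topspace X \<and> (\<exists>U\<in>u. openin X U \<and> U \<subseteq> A)}"
  unfolding Op_def
  by (subst generated_filter_eq[OF ultrafilter_on_filter[OF assms]])
    (auto simp: ultrafilter_on_top[OF assms] ultrafilter_on_Int[OF assms])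

lemma Cl_eq:
  assumes "ultrafilter_on (topspace X) u"
  shows "Cl X u = {A. A \<subseteq> topspace X \<and> (\<exists>C\<in>u. closedin X C \<and> C \<subseteq> A)}"
  unfolding Cl_def
  by (subst generated_filter_eq[OF ultrafilter_on_filter[OF assms]])
    (auto simp: ultrafilter_on_top[OF assms] ultrafilter_on_Int[OF assms])

lemma remote_ultrafilter_Op_eq_Cl:
  assumes "remote_ultrafilter X u"
  shows "Op X u = Cl X u"
proof -
  have "(\<exists>U\<in>u. openin X U \<and> U \<subseteq> A) \<longleftrightarrow> (\<exists>C\<in>u. closedin X C \<and> C \<subseteq> A)" for A
  proof
    assume "\<exists>U\<in>u. openin X U \<and> U \<subseteq> A"
    then obtain U where U: "U \<in> u" "openin X U" "U \<subseteq> A" by blast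
    obtain C where "C \<in> u" "closedin X C" "C \<subseteq> U"
      by (rule remote_ultrafilter_closed_subset[OF assms U(1,2)])
    with U(3) show "\<exists>C\<in>u. closedin X C \<and> C \<subseteq> A"
      by (intro bexI[of _ C]) auto
  next
    assume "\<exists>C\<in>u. closedin X C \<and> C \<subseteq> A"
    then obtain C where C: "C \<in> u" "closedin X C" "C \<subseteq> A" by blast
    obtain U where "U \<in> u" "openin X U" "U \<subseteq> C"
      by (rule remote_ultrafilter_open_subset[OF assms C(1,2)])
    with C(3) show "\<exists>U\<in>u. openin X U \<and> U \<subseteq> A"
      by (intro bexI[of _ U]) auto
  qed
  then show ?thesis
    using remote_ultrafilter_ultrafilter[OF assms] by (simp add: Op_eq Cl_eq)
qed

lemma remote_ultrafilter_nonprincipal: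
  assumes "remote_ultrafilter X u"
  shows "\<not> principal_on (topspace X) u"
  using remote_ultrafilter_not_NF[OF assms NF_sing] by (auto simp: principal_on_def)

lemma not_principal_on_sing:
  assumes "ultrafilter_on S u" "\<not> principal_on S u" "x \<in> S"
  shows "{x} \<notin> u"
proof
  assume "{x} \<in> u"
  note u = ultrafilter_on_dest[OF assms(1)]
  have "A \<in> u \<longleftrightarrow> A \<subseteq> S \<and> x \<in> A" for A
    using u(1)[of A] u(3) u(4)[OF _ \<open>{x} \<in> u\<close>, of A] u(5)[OF \<open>{x} \<in> u\<close>, of A]
    by (cases "x \<in> A") auto
  then have "u = {A. A \<subseteq> S \<and> x \<in> A}"
    by blast
  with assms(2,3) show False
    by (auto simp: principal_on_def)
qed

text \<open>A closed nowhere dense set contains no nonempty open set, so by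
  \<open>Op X u = Cl X u\<close> it is not in \<open>u\<close>. Its complement is then an open
  member and shrinks to a closed member. The complement of a point is treated likewise, being open
  by T1 and a member since \<open>u\<close> is not principal.\<close>

lemma remote_ultrafilter_if_Op_eq_Cl:
  assumes "t1_space X" and u: "ultrafilter_on (topspace X) u"
    and "\<not> principal_on (topspace X) u" and eq: "Op X u = Cl X u"
  shows "remote_ultrafilter X u"
proof (rule remote_ultrafilterI[OF u])
  have opcl: "(\<exists>U\<in>u. openin X U \<and> U \<subseteq> A) \<longleftrightarrow> (\<exists>C\<in>u. closedin X C \<and> C \<subseteq> A)" if "A \<subseteq> topspace X" for A
    using eq that unfolding Op_eq[OF u] Cl_eq[OF u] by blast
  show "\<exists>C\<in>u. closedin X C \<and> C \<inter> N = {}" if "nowhere_dense_in X N" for N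
  proof -
    let ?K = "X closure_of N"
    have "?K \<notin> u"
    proof
      assume "?K \<in> u"
      then have "\<exists>U\<in>u. openin X U \<and> U \<subseteq> ?K"
        by (intro iffD2[OF opcl] closure_of_subset_topspace bexI[of _ ?K]) simp_all
      then obtain U where "U \<in> u" "openin X U" "U \<subseteq> ?K"
        by blast
      then have "U = {}"
        using that interior_of_maximal[of U ?K X] unfolding nowhere_dense_in_def by blast
      with \<open>U \<in> u\<close> ultrafilter_on_empty[OF u] show False by blast
    qed
    then have "topspace X - ?K \<in> u"
      using ultrafilter_on_compl_iff[OF u, of ?K] by (simp add: closure_of_subset_topspace)
    then have "\<exists>C\<in>u. closedin X C \<and> C \<subseteq> topspace X - ?K"
      by (intro iffD1[OF opcl] bexI[of _ "topspace X - ?K"]) (auto simp: openin_diff)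
    moreover have "N \<subseteq> ?K"
      using that by (simp add: nowhere_dense_in_def closure_of_subset)
    ultimately show ?thesis by blast
  qed
  show "\<exists>C\<in>u. closedin X C \<and> x \<notin> C" if "x \<in> topspace X" for x
  proof -
    have "topspace X - {x} \<in> u"
      using ultrafilter_on_compl_iff[OF u, of "{x}"] not_principal_on_sing[OF u assms(3)] that by simp
    moreover have "openin X (topspace X - {x})"
      using assms(1) that by (simp add: t1_space_closedin_finite openin_diff)
    ultimately have "\<exists>C\<in>u. closedin X C \<and> C \<subseteq> topspace X - {x}"
      by (intro iffD1[OF opcl] bexI[of _ "topspace X - {x}"]) auto
    then show ?thesis by blast
  qed
qed

text \<open>Since \<open>Op X u\<close> and \<open>Cl X u\<close> coincide, every open or closed
  member of \<open>u\<close> belongs to this filter, which thus inherits from \<open>u\<close> the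
  decision about open and closed sets. A closed member missing \<open>x\<close> equals its closure,
  so \<open>x\<close> is no accumulation point.\<close>

lemma remote_ultrafilter_closed_open_ultrafilter:
  assumes "remote_ultrafilter X u"
  shows "closed_open_ultrafilter X (Op X u)" "\<nexists>x. accumulation_point X (Op X u) x"
proof -
  note U = remote_ultrafilter_ultrafilter[OF assms]
  note u = ultrafilter_on_dest[OF U]
  let ?F = "Op X u"
  have F_open: "A \<in> ?F \<longleftrightarrow> A \<subseteq> topspace X \<and> (\<exists>U\<in>u. openin X U \<and> U \<subseteq> A)" for A
    by (simp add: Op_eq[OF U])
  have F_closed: "A \<in> ?F \<longleftrightarrow> A \<subseteq> topspace X \<and> (\<exists>C\<in>u. closedin X C \<and> C \<subseteq> A)" for A
    by (simp add: remote_ultrafilter_Op_eq_Cl[OF assms] Cl_eq[OF U])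
  have Fu: "A \<in> u" if "A \<in> ?F" for A
    using that u(5) unfolding F_open by blast
  have openF: "A \<in> ?F" if "A \<in> u" "openin X A" for A
    using that u(1) unfolding F_open by blast
  have closedF: "A \<in> ?F" if "A \<in> u" "closedin X A" for A
    using that u(1) unfolding F_closed by blast
  have filter: "filter_on (topspace X) ?F"
    unfolding Op_def
  proof (rule filter_on_generated_filter)
    fix \<C> assume "finite \<C>" "\<C> \<subseteq> {A \<in> u. openin X A}"
    then have "topspace X \<inter> \<Inter>\<C> \<in> u"
      by (intro filter_on_Inter[OF u(6)]) auto
    then show "topspace X \<inter> \<Inter>\<C> \<noteq> {}"
      using u(3) by metis
  qed
  have "open_filter X ?F"
    unfolding open_filter_def
  proof (intro conjI ballI filter)
    fix A assume "A \<in> ?F"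
    then show "\<exists>U\<in>?F. openin X U \<and> U \<subseteq> A"
      using openF unfolding F_open[of A] by blast
  qed
  moreover have "closed_filter X ?F"
    unfolding closed_filter_def
  proof (intro conjI ballI filter)
    fix A assume "A \<in> ?F"
    then show "\<exists>C\<in>?F. closedin X C \<and> C \<subseteq> A"
      using closedF unfolding F_closed[of A] by blast
  qed
  moreover have "A \<in> ?F \<or> topspace X - A \<in> ?F" if "openin X A" for A
  proof (cases "A \<in> u")
    case False
    then have "topspace X - A \<in> u"
      by (simp add: ultrafilter_on_compl_iff[OF U openin_subset[OF that]])
    then show ?thesis using closedF that by blast
  qed (use that openF in simp)
  moreover have "A \<in> ?F \<or> topspace X - A \<in> ?F" if "closedin X A" for A
  proof (cases "A \<in> u")
    case False
    then have "topspace X - A \<in> u"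
      by (simp add: ultrafilter_on_compl_iff[OF U closedin_subset[OF that]])
    then show ?thesis using openF that by blast
  qed (use that closedF in simp)
  ultimately show "closed_open_ultrafilter X ?F"
    by (simp add: closed_open_ultrafilter_def closed_ultrafilter_def open_ultrafilter_def)
  show "\<nexists>x. accumulation_point X ?F x"
  proof
    assume "\<exists>x. accumulation_point X ?F x"
    then obtain x where x: "x \<in> topspace X" "\<And>A. A \<in> ?F \<Longrightarrow> x \<in> X closure_of A"
      unfolding accumulation_point_def by blast
    obtain C where C: "C \<in> u" "closedin X C" "C \<inter> {x} = {}"
      using remote_ultrafilter_NF[OF assms NF_sing[OF x(1)]] by blast
    then have "x \<in> X closure_of C"
      by (intro x(2) closedF)
    then show False
      using C by (simp add: closure_of_closedin)
  qed
qed

text \<open>The closed sets required already come from \<open>F\<close>: its open base excludes the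
  closure of a nowhere dense set, so \<open>F\<close> contains the complement, and its closed base
  then yields a closed set inside. For a point, the closure of a member witnessing non-accumulation
  serves. Passing to \<open>u\<close> only decides the remaining sets.\<close>

lemma remote_ultrafilter_if_closed_open_ultrafilter:
  assumes "closed_open_ultrafilter X F" and "\<nexists>x. accumulation_point X F x"
    and u: "ultrafilter_on (topspace X) u" and "F \<subseteq> u"
  shows "remote_ultrafilter X u"
proof (rule remote_ultrafilterI[OF u])
  have F: "filter_on (topspace X) F" "\<And>A. A \<in> F \<Longrightarrow> \<exists>C\<in>F. closedin X C \<and> C \<subseteq> A"
    "\<And>A. A \<in> F \<Longrightarrow> \<exists>U\<in>F. openin X U \<and> U \<subseteq> A"
    "\<And>A. closedin X A \<Longrightarrow> A \<in> F \<or> topspace X - A \<in> F"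
    using assms(1) unfolding closed_open_ultrafilter_def closed_ultrafilter_def
      open_ultrafilter_def closed_filter_def open_filter_def by auto
  show "\<exists>C\<in>u. closedin X C \<and> C \<inter> N = {}" if "nowhere_dense_in X N" for N
  proof -
    let ?K = "X closure_of N"
    have "?K \<notin> F"
    proof
      assume "?K \<in> F"
      then obtain U where "U \<in> F" "openin X U" "U \<subseteq> ?K"
        using F(3) by blast
      then have "U = {}"
        using that interior_of_maximal[of U ?K X] unfolding nowhere_dense_in_def by blast
      with \<open>U \<in> F\<close> F(1) show False unfolding filter_on_def by blast
    qed
    then have "topspace X - ?K \<in> F"
      using F(4)[of ?K] by simp
    then obtain C where "C \<in> F" "closedin X C" "C \<subseteq> topspace X - ?K"
      using F(2) by blast
    moreover have "N \<subseteq> ?K"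
      using that by (simp add: nowhere_dense_in_def closure_of_subset)
    ultimately show ?thesis
      using \<open>F \<subseteq> u\<close> by blast
  qed
  show "\<exists>C\<in>u. closedin X C \<and> x \<notin> C" if x: "x \<in> topspace X" for x
  proof -
    obtain A where "A \<in> F" "x \<notin> X closure_of A"
      using assms(2) x unfolding accumulation_point_def by blast
    moreover have "A \<subseteq> X closure_of A"
      using \<open>A \<in> F\<close> u \<open>F \<subseteq> u\<close> by (intro closure_of_subset ultrafilter_on_subset[OF u]) blast
    ultimately have "X closure_of A \<in> u"
      using ultrafilter_on_mono[OF u, of A "X closure_of A"] \<open>F \<subseteq> u\<close>
      by (auto simp: closure_of_subset_topspace)
    then show ?thesis
      using \<open>x \<notin> X closure_of A\<close> by (intro bexI[of _ "X closure_of A"]) simp_all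
  qed
qed

section \<open>NF-compactness\<close>

lemma remote_ultrafilter_not_ideal_compact:
  assumes "remote_ultrafilter X u"
  shows "\<not> ideal_compact X (NF X)"
proof
  note u = ultrafilter_on_dest[OF remote_ultrafilter_ultrafilter[OF assms]]
  assume "ideal_compact X (NF X)"
  \<comment> \<open>The sets \<open>topspace X - \<gamma> A\<close> will be the open sets assigned
    to the members of the ideal. A finite subcover would mean that finitely many members of
    \<open>u\<close> have empty intersection.\<close>
  obtain \<gamma> where \<gamma>: "\<And>A. A \<in> NF X \<Longrightarrow> \<gamma> A \<in> u \<and> closedin X (\<gamma> A) \<and> \<gamma> A \<inter> A = {}"
    using assms unfolding remote_ultrafilter_def by metis
  have "openin X (topspace X - \<gamma> A) \<and> A \<subseteq> topspace X - \<gamma> A" if "A \<in> NF X" for A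
    using \<gamma>[OF that] NF_subset[OF that] by auto
  then obtain \<A> where \<A>: "finite \<A>" "\<A> \<subseteq> NF X" "(\<Union>A\<in>\<A>. topspace X - \<gamma> A) = topspace X"
    using \<open>ideal_compact X (NF X)\<close> unfolding ideal_compact_def by meson
  have "topspace X \<inter> \<Inter>(\<gamma> ` \<A>) \<in> u"
    using \<A> \<gamma> by (intro filter_on_Inter[OF u(6)]) auto
  moreover have "topspace X \<inter> \<Inter>(\<gamma> ` \<A>) = {}"
    using \<A>(3) by blast
  ultimately show False using u(3) by simp
qed

text \<open>Without a finite subcover the closed complements of the sets \<open>\<phi> A\<close>
  have the finite intersection property. Any ultrafilter containing them is as required, because the
  complement of \<open>\<phi> A\<close> misses \<open>A\<close>.\<close>

lemma remote_ultrafilter_if_not_ideal_compact: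
  assumes "\<not> ideal_compact X (NF X)"
  obtains u where "remote_ultrafilter X u"
proof -
  obtain \<phi> where \<phi>: "\<And>A. A \<in> NF X \<Longrightarrow> openin X (\<phi> A) \<and> A \<subseteq> \<phi> A"
    and no: "\<And>\<A>. finite \<A> \<Longrightarrow> \<A> \<subseteq> NF X \<Longrightarrow> (\<Union>A\<in>\<A>. \<phi> A) \<noteq> topspace X"
    using assms unfolding ideal_compact_def by (simp only: not_all not_imp not_ex de_Morgan_conj) metis
  define \<B> where "\<B> = (\<lambda>A. topspace X - \<phi> A) ` NF X"
  have "filter_on (topspace X) (generated_filter (topspace X) \<B>)"
  proof (rule filter_on_generated_filter)
    fix \<C> assume "finite \<C>" "\<C> \<subseteq> \<B>"
    then obtain \<A> where "finite \<A>" "\<A> \<subseteq> NF X" and \<C>: "\<C> = (\<lambda>A. topspace X - \<phi> A) ` \<A>"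
      unfolding \<B>_def by (metis finite_subset_image)
    moreover have "(\<Union>A\<in>\<A>. \<phi> A) \<subseteq> topspace X"
      using \<phi> \<open>\<A> \<subseteq> NF X\<close> by (meson UN_least openin_subset subsetD)
    ultimately have "\<exists>x\<in>topspace X. x \<notin> (\<Union>A\<in>\<A>. \<phi> A)"
      using no by blast
    then show "topspace X \<inter> \<Inter>\<C> \<noteq> {}"
      unfolding \<C> by blast
  qed
  then obtain u where u: "ultrafilter_on (topspace X) u" "generated_filter (topspace X) \<B> \<subseteq> u"
    by (rule ultrafilter_extends_filter)
  have "\<B> \<subseteq> u"
    using subset_generated_filter[of \<B> "topspace X"] u(2) unfolding \<B>_def by blast
  then have "\<exists>C\<in>u. closedin X C \<and> C \<inter> A = {}" if "A \<in> NF X" for A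
    using \<phi>[OF that] that unfolding \<B>_def by (intro bexI[of _ "topspace X - \<phi> A"]) auto
  with u(1) show thesis
    by (intro that[of u]) (simp add: remote_ultrafilter_def)
qed

section \<open>Remote points\<close>

lemma continuous_map_SC_map: "continuous_map X (Stone_Cech X) (SC_map X)"
proof -
  have "continuous_map X (SC_cube X) (SC_map X)"
    unfolding SC_cube_def continuous_map_componentwise
    by (auto simp: SC_map_def unit_functions_def)
  then show ?thesis
    using SC_map_subset_closure unfolding Stone_Cech_def continuous_map_in_subtopology by fast
qed

text \<open>A Urysohn function separating \<open>C\<close> from \<open>D\<close> extends to beta(X).
  The extension is constantly 0 on one closure and constantly 1 on the other.\<close>

lemma Stone_Cech_disjoint_closures:
  assumes "normal_space X" "closedin X C" "closedin X D" "C \<inter> D = {}"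
  shows "Stone_Cech X closure_of (SC_map X ` C) \<inter> Stone_Cech X closure_of (SC_map X ` D) = {}"
proof -
  obtain g where g: "continuous_map X (top_of_set {0..1::real}) g" "g ` C \<subseteq> {0}" "g ` D \<subseteq> {1}"
    using Urysohn_lemma[OF assms(1-3), of 0 1] assms(4) by (auto simp: disjnt_def)
  obtain h where h: "continuous_map (Stone_Cech X) (top_of_set {0..1::real}) h"
    "\<And>x. x \<in> topspace X \<Longrightarrow> h (SC_map X x) = g x"
    using Stone_Cech_extension[OF g(1)] by blast
  \<comment> \<open>The level sets of the extension \<open>h\<close> are closed, so \<open>h\<close>
    keeps its constant value when passing to the closure.\<close>
  have *: "Stone_Cech X closure_of (SC_map X ` E) \<subseteq> {p. h p = r}"
    if "closedin X E" "g ` E \<subseteq> {r}" "r \<in> {0..1}" for E r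
  proof -
    have "closedin (Stone_Cech X) {p \<in> topspace (Stone_Cech X). h p \<in> {r}}"
      using h(1) that(3)
      by (intro closedin_continuous_map_preimage) (auto simp: closedin_subtopology intro!: exI[of _ "{r}"])
    moreover have "SC_map X ` E \<subseteq> {p \<in> topspace (Stone_Cech X). h p \<in> {r}}"
      using closedin_subset[OF that(1)] that(2) h(2) continuous_map_SC_map[of X]
      by (fastforce simp: continuous_map_def)
    ultimately have "Stone_Cech X closure_of (SC_map X ` E) \<subseteq> {p \<in> topspace (Stone_Cech X). h p \<in> {r}}"
      by (rule closure_of_minimal[rotated])
    then show ?thesis by blast
  qed
  show ?thesis
    using *[OF assms(2) g(2)] *[OF assms(3) g(3)] by fastforce
qed

lemma remote_ultrafilter_if_remote_point:
  assumes "remote_point X p"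
  obtains u where "remote_ultrafilter X u"
proof -
  let ?b = "Stone_Cech X" and ?S = "topspace X"
  define tr where "tr V = {x \<in> topspace X. SC_map X x \<in> V}" for V
  have p: "p \<in> topspace ?b" "p \<notin> SC_map X ` topspace X"
    "\<And>N. nowhere_dense_in X N \<Longrightarrow> p \<notin> ?b closure_of (SC_map X ` N)"
    using assms unfolding remote_point_def by auto
  define F where "F = {A. A \<subseteq> ?S \<and> (\<exists>V. openin ?b V \<and> p \<in> V \<and> tr V \<subseteq> A)}"
  have F: "A \<in> F" if "openin ?b V" "p \<in> V" "tr V \<subseteq> A" "A \<subseteq> ?S" for A V
    using that by (auto simp: F_def)
  have "filter_on ?S F"
  proof (rule filter_onI)
    fix A B
    show "A \<subseteq> ?S" if "A \<in> F"
      using that by (simp add: F_def)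
    show "A \<inter> B \<in> F" if AB: "A \<in> F" "B \<in> F"
    proof -
      obtain V where "openin ?b V" "p \<in> V" "tr V \<subseteq> A" "A \<subseteq> ?S"
        using AB(1) by (auto simp: F_def)
      moreover obtain W where "openin ?b W" "p \<in> W" "tr W \<subseteq> B"
        using AB(2) by (auto simp: F_def)
      ultimately show ?thesis
        by (intro F[of "V \<inter> W"]) (auto simp: tr_def)
    qed
    show "B \<in> F" if A: "A \<in> F" "A \<subseteq> B" "B \<subseteq> ?S"
    proof -
      obtain V where "openin ?b V" "p \<in> V" "tr V \<subseteq> A"
        using A(1) by (auto simp: F_def)
      with A(2,3) show ?thesis
        by (intro F[of V]) simp_all
    qed
  next
    show "?S \<in> F"
      using p(1) by (intro F[of "topspace ?b"]) (auto simp: tr_def)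
    \<comment> \<open>Density of the image of \<open>X\<close> in beta(X) makes the trace of each
      neighbourhood of \<open>p\<close> nonempty.\<close>
    have "tr V \<noteq> {}" if "openin ?b V" "p \<in> V" for V
    proof -
      have "p \<in> ?b closure_of (SC_map X ` ?S)"
        using p(1) by (simp add: dense_Stone_Cech)
      with that obtain y where "y \<in> SC_map X ` ?S" "y \<in> V"
        unfolding in_closure_of by blast
      then show ?thesis by (auto simp: tr_def)
    qed
    then show "{} \<notin> F"
      by (auto simp: F_def)
  qed
  then obtain u where u: "ultrafilter_on ?S u" "F \<subseteq> u"
    by (rule ultrafilter_extends_filter)
  \<comment> \<open>Regularity of beta(X) gives a neighbourhood \<open>V\<close> of \<open>p\<close>
    whose closure misses the closure of the image of \<open>A\<close>. The trace of the closure of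
    \<open>V\<close> is the closed member sought.\<close>
  have sep: "\<exists>C\<in>u. closedin X C \<and> C \<inter> A = {}"
    if A: "A \<subseteq> ?S" "p \<notin> ?b closure_of (SC_map X ` A)" for A
  proof -
    obtain V where V: "openin ?b V" "p \<in> V" "disjnt (?b closure_of (SC_map X ` A)) (?b closure_of V)"
      using compact_Hausdorff_imp_regular_space[OF compact_space_Stone_Cech Hausdorff_space_Stone_Cech]
        A(2) p(1) unfolding regular_space by (metis DiffI closedin_closure_of)
    have "closedin X (tr (?b closure_of V))"
      unfolding tr_def by (intro closedin_continuous_map_preimage[OF continuous_map_SC_map]) simp
    moreover have "tr (?b closure_of V) \<in> u"
      using closure_of_subset[OF openin_subset[OF V(1)]]
      by (intro subsetD[OF u(2)] F[OF V(1,2)]) (auto simp: tr_def)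
    moreover have "SC_map X ` A \<subseteq> ?b closure_of (SC_map X ` A)"
      using A(1) continuous_map_SC_map[of X] by (intro closure_of_subset) (auto simp: continuous_map_def)
    then have "tr (?b closure_of V) \<inter> A = {}"
      using V(3) unfolding tr_def disjnt_iff by blast
    ultimately show ?thesis by blast
  qed
  have "remote_ultrafilter X u"
  proof (rule remote_ultrafilterI[OF u(1)])
    show "\<exists>C\<in>u. closedin X C \<and> C \<inter> N = {}" if "nowhere_dense_in X N" for N
      using sep p(3)[OF that] that unfolding nowhere_dense_in_def by blast
    show "\<exists>C\<in>u. closedin X C \<and> x \<notin> C" if x: "x \<in> ?S" for x
    proof -
      have "SC_map X x \<in> topspace ?b"
        using x continuous_map_SC_map[of X] by (auto simp: continuous_map_def)
      then have "closedin ?b (SC_map X ` {x})"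
        using closedin_Hausdorff_singleton[OF Hausdorff_space_Stone_Cech] by simp
      then have "p \<notin> ?b closure_of (SC_map X ` {x})"
        using p(2) x by (auto simp: closure_of_closedin)
      then show ?thesis using sep[of "{x}"] x by auto
    qed
  qed
  then show thesis by (rule that)
qed

text \<open>By compactness the closures in beta(X) of all members of \<open>u\<close> have a common
  point \<open>p\<close>. If a closed member misses a closed set of the ideal, the two closures are
  disjoint, so \<open>p\<close> avoids the closure of that set.\<close>

lemma remote_point_if_remote_ultrafilter:
  assumes "normal_space X" "t1_space X" "remote_ultrafilter X u"
  obtains p where "remote_point X p"
proof -
  let ?b = "Stone_Cech X" and ?S = "topspace X"
  note u = ultrafilter_on_dest[OF remote_ultrafilter_ultrafilter[OF assms(3)]]
  define cl where "cl A = ?b closure_of (SC_map X ` A)" for A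
  have img: "SC_map X ` A \<subseteq> topspace ?b" if "A \<subseteq> ?S" for A
    using that continuous_map_SC_map[of X] by (auto simp: continuous_map_def)
  have fip: "\<Inter>\<D> \<noteq> {}" if D: "finite \<D>" "\<D> \<subseteq> cl ` u" for \<D>
  proof -
    obtain \<C> where C: "finite \<C>" "\<C> \<subseteq> u" "\<D> = cl ` \<C>"
      using D by (metis finite_subset_image)
    have "?S \<inter> \<Inter>\<C> \<in> u"
      by (rule filter_on_Inter[OF u(6) C(1,2)])
    then obtain x where x: "x \<in> ?S" "x \<in> \<Inter>\<C>"
      using u(3) by (metis Int_iff all_not_in_conv)
    have "SC_map X x \<in> cl A" if "A \<in> \<C>" for A
    proof -
      have "A \<in> u" using that C(2) by blast
      then have "SC_map X ` A \<subseteq> cl A"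
        unfolding cl_def by (intro closure_of_subset img u(1))
      with x(2) that show ?thesis by blast
    qed
    then show ?thesis using C(3) by blast
  qed
  have "\<Inter>(cl ` u) \<noteq> {}"
    by (rule compact_space_fip[THEN iffD1, OF compact_space_Stone_Cech[of X], THEN spec, THEN mp])
      (use fip in \<open>auto simp: cl_def\<close>)
  then obtain p where p: "\<And>A. A \<in> u \<Longrightarrow> p \<in> cl A"
    by blast
  have disj: "p \<notin> cl A" if A: "A \<in> NF X" "closedin X A" for A
  proof -
    obtain C where "C \<in> u" "closedin X C" "C \<inter> A = {}"
      using remote_ultrafilter_NF[OF assms(3) A(1)] by blast
    then show ?thesis
      using Stone_Cech_disjoint_closures[OF assms(1) _ A(2), of C] p unfolding cl_def by blast
  qed
  have "p \<in> topspace ?b"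
    using p[OF u(2)] by (simp add: cl_def dense_Stone_Cech)
  moreover have "p \<notin> SC_map X ` ?S"
  proof
    assume "p \<in> SC_map X ` ?S"
    then obtain x where x: "x \<in> ?S" "p = SC_map X x" by blast
    have "closedin X {x}"
      using assms(2) x(1) by (simp add: t1_space_closedin_finite)
    then have "p \<notin> cl {x}"
      by (intro disj NF_sing x(1))
    then show False
      using closure_of_subset[OF img[of "{x}"]] x unfolding cl_def by simp
  qed
  moreover have "p \<notin> ?b closure_of (SC_map X ` N)" if "nowhere_dense_in X N" for N
  proof -
    \<comment> \<open>Disjointness of closures is available for closed sets only, so
      \<open>N\<close> is replaced by its closure, which is still nowhere dense.\<close>
    have "p \<notin> cl (X closure_of N)"
      by (intro disj NF_nowhere_dense nowhere_dense_in_closure that) simp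
    moreover have "N \<subseteq> X closure_of N"
      using that closure_of_subset unfolding nowhere_dense_in_def by blast
    then have "?b closure_of (SC_map X ` N) \<subseteq> cl (X closure_of N)"
      unfolding cl_def by (intro closure_of_mono image_mono)
    ultimately show ?thesis by blast
  qed
  ultimately show thesis
    by (intro that[of p]) (simp add: remote_point_def)
qed

section \<open>Finitely additive measures\<close>

text \<open>The value \<open>c\<close> is left open so that 1 and \<infinity> can both be inserted
  later.\<close>

lemma remote_ultrafilter_measure:
  assumes "remote_ultrafilter X u"
  defines "\<mu> \<equiv> \<lambda>c A. if A \<in> u then c else (0::ennreal)"
  shows "finitely_additive_measure (wB X) (\<mu> c)"
    and "outer_regular_on X (wB X) (\<mu> c)"
    and "A \<in> NF X \<Longrightarrow> \<mu> c A = 0"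
    and "\<mu> c (topspace X) = c"
proof -
  note U = remote_ultrafilter_ultrafilter[OF assms(1)]
  note u = ultrafilter_on_dest[OF U]
  show "A \<in> NF X \<Longrightarrow> \<mu> c A = 0"
    using remote_ultrafilter_not_NF[OF assms(1)] unfolding \<mu>_def by simp
  show "\<mu> c (topspace X) = c"
    using u(2) unfolding \<mu>_def by simp
  show "finitely_additive_measure (wB X) (\<mu> c)"
    unfolding additive_def
  proof (intro ballI impI)
    fix A B assume "A \<in> wB X" "B \<in> wB X" "A \<inter> B = {}"
    moreover from this have "\<not> (A \<in> u \<and> B \<in> u)"
      using u(3,4) by metis
    ultimately show "\<mu> c (A \<union> B) = \<mu> c A + \<mu> c B"
      using ultrafilter_on_Un_iff[OF U wB_subset wB_subset] unfolding \<mu>_def by auto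
  qed
  show "outer_regular_on X (wB X) (\<mu> c)"
    unfolding outer_regular_on_def
  proof
    fix A assume A: "A \<in> wB X"
    let ?I = "{\<mu> c U |U. openin X U \<and> A \<subseteq> U}"
    show "\<mu> c A = Inf ?I"
    proof (cases "A \<in> u")
      case True
      \<comment> \<open>Every open superset of a member has value \<open>c\<close>, and the whole
        space is one, so the infimum is taken over exactly \<open>{c}\<close>.\<close>
      then have "V \<in> u" if "openin X V" "A \<subseteq> V" for V
        using that openin_subset by (blast intro: u(5)[of A])
      then have "?I = {c}"
        using wB_subset[OF A] unfolding \<mu>_def by (auto intro!: exI[of _ "topspace X"])
      then show ?thesis using True unfolding \<mu>_def by simp
    next
      case False
      obtain U P Q where UPQ: "A = (U - P) \<union> Q" "openin X U" "nowhere_dense_in X P" "nowhere_dense_in X Q"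
        using A unfolding wB_def by blast
      note nd = UPQ(3,4)[unfolded nowhere_dense_in_def]
      have "P \<notin> u"
        by (rule remote_ultrafilter_not_NF[OF assms(1) NF_nowhere_dense[OF UPQ(3)]])
      moreover have "U - P \<notin> u"
        using False UPQ(1) u(5)[of "U - P" A] wB_subset[OF A] by blast
      ultimately have "(U - P) \<union> P \<notin> u"
        using ultrafilter_on_Un_iff[OF U, of "U - P" P] openin_subset[OF UPQ(2)] nd by blast
      then have "U \<notin> u"
        using u(5)[of U "U - P \<union> P"] openin_subset[OF UPQ(2)] nd by blast
      obtain C where C: "C \<in> u" "closedin X C" "C \<inter> Q = {}"
        using remote_ultrafilter_NF[OF assms(1) NF_nowhere_dense[OF UPQ(4)]] by blast
      \<comment> \<open>An open superset of \<open>A\<close> of measure zero: \<open>U\<close>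
        covers the part \<open>U - P\<close>, the complement of \<open>C\<close> covers
        \<open>Q\<close>, and neither of the two open sets is in \<open>u\<close>.\<close>
      let ?V = "U \<union> (topspace X - C)"
      have "?V \<notin> u"
        using ultrafilter_on_Un_iff[OF U, of U "topspace X - C"] \<open>U \<notin> u\<close> openin_subset[OF UPQ(2)]
          ultrafilter_on_compl_iff[OF U, of C] C(1) u(1) by auto
      moreover have "openin X ?V" "A \<subseteq> ?V"
        using UPQ C nd by auto
      ultimately have "0 \<in> ?I"
        unfolding \<mu>_def by (auto intro!: exI[of _ ?V])
      then have "Inf ?I \<le> 0"
        by (rule Inf_lower)
      then show ?thesis
        using False unfolding \<mu>_def by simp
    qed
  qed
qed

text \<open>The union is split disjointly into \<open>U\<close> and \<open>V - U\<close>, and the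
  measure of \<open>V - U\<close> is bounded by splitting \<open>V\<close> along \<open>U\<close>.
  Both splittings stay inside the algebra.\<close>

lemma additive_wB_Un_le:
  assumes "finitely_additive_measure (wB X) \<mu>" "openin X U" "openin X V"
  shows "\<mu> (U \<union> V) \<le> \<mu> U + \<mu> V"
proof -
  have add: "\<mu> (A \<union> B) = \<mu> A + \<mu> B" if "A \<in> wB X" "B \<in> wB X" "A \<inter> B = {}" for A B
    using assms(1) that unfolding additive_def by blast
  have "\<mu> ((V \<inter> U) \<union> (V - U)) = \<mu> (V \<inter> U) + \<mu> (V - U)"
    using assms(2,3) by (intro add openin_wB openin_Diff_wB) auto
  moreover have "(V \<inter> U) \<union> (V - U) = V" by blast
  ultimately have "\<mu> (V - U) \<le> \<mu> V" by simp
  moreover have "\<mu> (U \<union> (V - U)) = \<mu> U + \<mu> (V - U)"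
    using assms(2,3) by (intro add openin_wB openin_Diff_wB) auto
  then have "\<mu> (U \<union> V) = \<mu> U + \<mu> (V - U)" by simp
  ultimately show ?thesis by (simp add: add_left_mono)
qed

lemma ideal_compact_finite_measure:
  assumes add: "finitely_additive_measure (wB X) \<mu>" and "ideal_compact X (NF X)"
    and fin: "\<And>A. A \<in> NF X \<Longrightarrow> \<exists>U. openin X U \<and> A \<subseteq> U \<and> \<mu> U < \<infinity>"
  shows "\<mu> (topspace X) < \<infinity>"
proof -
  obtain \<phi> where \<phi>: "\<And>A. A \<in> NF X \<Longrightarrow> openin X (\<phi> A) \<and> A \<subseteq> \<phi> A \<and> \<mu> (\<phi> A) < \<infinity>"
    using fin by metis
  then obtain \<A> where \<A>: "finite \<A>" "\<A> \<subseteq> NF X" "(\<Union>A\<in>\<A>. \<phi> A) = topspace X"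
    using assms(2) unfolding ideal_compact_def by meson
  have "{} \<in> NF X"
    by (rule NF_nowhere_dense[OF nowhere_dense_in_empty])
  \<comment> \<open>Additivity alone allows an infinite value at the empty set. One open set of
    finite measure rules this out, which the base case of the induction over the cover
    requires.\<close>
  then obtain U where U: "openin X U" "\<mu> U < \<infinity>"
    using fin by blast
  have "\<mu> ({} \<union> U) = \<mu> {} + \<mu> U"
    by (intro add[unfolded additive_def, rule_format]) (auto intro: openin_wB U(1))
  then have "\<mu> {} \<le> \<mu> U"
    by (metis Un_empty_left add.commute add_increasing order_refl zero_le)
  with U(2) have "\<mu> {} < \<infinity>" by (rule le_less_trans[rotated])
  from \<A>(1,2) have "\<mu> (\<Union>A\<in>\<A>. \<phi> A) < \<infinity>"
  proof (induction \<A>)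
    case empty
    then show ?case using \<open>\<mu> {} < \<infinity>\<close> by simp
  next
    case (insert A \<A>)
    have "\<mu> (\<Union>A\<in>insert A \<A>. \<phi> A) \<le> \<mu> (\<phi> A) + \<mu> (\<Union>A\<in>\<A>. \<phi> A)"
      using \<phi> insert.prems unfolding UN_insert by (intro additive_wB_Un_le[OF add] openin_Union) auto
    also have "\<dots> < \<infinity>"
      using insert \<phi> by auto
    finally show ?case .
  qed
  then show ?thesis unfolding \<A>(3) .
qed

lemma outer_regular_on_less:
  assumes "outer_regular_on X \<A> \<mu>" "A \<in> \<A>" "\<mu> A < c"
  obtains U where "openin X U" "A \<subseteq> U" "\<mu> U < c"
  using assms unfolding outer_regular_on_def by (auto simp: Inf_less_iff)

theorem theorem1p7:
  fixes X :: "'a topology"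
  assumes "normal_space X" and "t1_space X"
  defines "a \<equiv> \<exists>p. remote_point X p"
    and "b \<equiv> \<exists>\<F>. closed_open_ultrafilter X \<F> \<and> (\<nexists>x. accumulation_point X \<F> x)"
    and "c \<equiv> \<exists>u. ultrafilter_on (topspace X) u \<and> \<not> principal_on (topspace X) u \<and> Op X u = Cl X u"
    and "d \<equiv> \<not> ideal_compact X (NF X)"
    and "e \<equiv> \<exists>\<mu>. finitely_additive_01_measure X (wB X) \<mu> \<and> outer_regular_on X (wB X) \<mu> \<and>
               (\<forall>A\<in>NF X. \<mu> A = 0)"
    and "f \<equiv> \<exists>\<mu>. finitely_additive_measure (wB X) \<mu> \<and> outer_regular_on X (wB X) \<mu> \<and>
               \<mu> (topspace X) = \<infinity> \<and> (\<forall>A\<in>NF X. \<mu> A < \<infinity>)"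
  shows "(a \<longleftrightarrow> b) \<and> (a \<longleftrightarrow> c) \<and> (a \<longleftrightarrow> d) \<and> (a \<longleftrightarrow> e) \<and> (a \<longleftrightarrow> f)"
proof -
  \<comment> \<open>The first four conditions are each shown equivalent to \<open>k\<close>; the two
    measure conditions follow from \<open>k\<close> and lead back to it through
    \<open>d\<close>.\<close>
  define k where "k \<longleftrightarrow> (\<exists>u. remote_ultrafilter X u)"
  have "a \<longleftrightarrow> k"
    unfolding a_def k_def
    using remote_ultrafilter_if_remote_point remote_point_if_remote_ultrafilter[OF assms(1,2)] by metis
  moreover have "b \<longleftrightarrow> k"
  proof
    assume b
    then obtain \<F> where F: "closed_open_ultrafilter X \<F>" "\<nexists>x. accumulation_point X \<F> x"
      unfolding b_def by blast
    then have "filter_on (topspace X) \<F>"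
      unfolding closed_open_ultrafilter_def closed_ultrafilter_def closed_filter_def by blast
    then show k
      using remote_ultrafilter_if_closed_open_ultrafilter[OF F] ultrafilter_extends_filter
      unfolding k_def by metis
  qed (use remote_ultrafilter_closed_open_ultrafilter in \<open>unfold b_def k_def, blast\<close>)
  moreover have "c \<longleftrightarrow> k"
    unfolding c_def k_def
    using remote_ultrafilter_if_Op_eq_Cl[OF assms(2)] remote_ultrafilter_ultrafilter
      remote_ultrafilter_nonprincipal remote_ultrafilter_Op_eq_Cl by metis
  moreover have "d \<longleftrightarrow> k"
    unfolding d_def k_def
    using remote_ultrafilter_if_not_ideal_compact remote_ultrafilter_not_ideal_compact by metis
  moreover have e if k
  proof -
    from that obtain u where u: "remote_ultrafilter X u" unfolding k_def by blast
    show e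
      unfolding e_def finitely_additive_01_measure_def
      by (rule exI[of _ "\<lambda>A. if A \<in> u then 1 else 0"])
        (use remote_ultrafilter_measure[OF u, where c = 1] in simp)
  qed
  moreover have f if k
  proof -
    from that obtain u where u: "remote_ultrafilter X u" unfolding k_def by blast
    show f
      unfolding f_def
      by (rule exI[of _ "\<lambda>A. if A \<in> u then \<infinity> else 0"])
        (use remote_ultrafilter_measure[OF u, where c = \<infinity>] in simp)
  qed
  moreover have d if e
  proof -
    from that obtain \<mu> where \<mu>: "finitely_additive_measure (wB X) \<mu>" "\<mu> (topspace X) = 1"
      "\<forall>A\<in>wB X. \<mu> A = 0 \<or> \<mu> A = 1" "outer_regular_on X (wB X) \<mu>" "\<forall>A\<in>NF X. \<mu> A = 0"
      unfolding e_def finitely_additive_01_measure_def by blast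
    \<comment> \<open>Scaling by \<open>\<infinity>\<close> turns measure zero into finite measure.\<close>
    have "finitely_additive_measure (wB X) (\<lambda>A. \<infinity> * \<mu> A)"
      using \<mu>(1) unfolding additive_def by (simp add: distrib_left)
    moreover have "\<exists>U. openin X U \<and> A \<subseteq> U \<and> \<infinity> * \<mu> U < \<infinity>" if A: "A \<in> NF X" for A
    proof -
      \<comment> \<open>The bound 1 suffices: an open set of measure below 1 has measure 0, as no
        other values occur.\<close>
      obtain U where U: "openin X U" "A \<subseteq> U" "\<mu> U < 1"
        using outer_regular_on_less[OF \<mu>(4), of A 1] NF_subset_wB[OF assms(2)] \<mu>(5) A by auto
      then have "\<mu> U = 0"
        using \<mu>(3) openin_wB by force
      with U show ?thesis by (intro exI[of _ U]) simp
    qed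
    ultimately show d
      using ideal_compact_finite_measure[of X "\<lambda>A. \<infinity> * \<mu> A"] \<mu>(2) unfolding d_def by auto
  qed
  moreover have d if f
  proof -
    from that obtain \<mu> where \<mu>: "finitely_additive_measure (wB X) \<mu>" "\<mu> (topspace X) = \<infinity>"
      "outer_regular_on X (wB X) \<mu>" "\<forall>A\<in>NF X. \<mu> A < \<infinity>"
      unfolding f_def by blast
    have fin: "\<exists>U. openin X U \<and> A \<subseteq> U \<and> \<mu> U < \<infinity>" if A: "A \<in> NF X" for A
    proof -
      have "A \<in> wB X" "\<mu> A < \<infinity>"
        using NF_subset_wB[OF assms(2)] \<mu>(4) A by blast+
      then obtain U where "openin X U" "A \<subseteq> U" "\<mu> U < \<infinity>"
        by (rule outer_regular_on_less[OF \<mu>(3)])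
      then show ?thesis by blast
    qed
    have "\<mu> (topspace X) < \<infinity>" if "ideal_compact X (NF X)"
      using \<mu>(1) that fin by (rule ideal_compact_finite_measure)
    with \<mu>(2) show d
      unfolding d_def by auto
  qed
  ultimately show ?thesis by blast
qed

end
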